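(* For $n\ge3$, let $D_n=\langle a,b\mid a^n=b^2=e,\ ba=a^{n-1}b\rangle$ be the dihedral group of order $2n$. In the directed Cayley graph $\Gamma(D_n,\{a,b\})$ the Lin--Lu--Yau Ricci curvatures of the arcs $(e,a)$ and $(e,b)$ are $$\kappa(e,a)=\begin{cases}-\tfrac12,& n=3,\\ -1,& n\ge4,\end{cases}\qquad \kappa(e,b)=\begin{cases}\tfrac12,& n=3,\\ 0,& n\ge4.\end{cases}$$
   Context: For a group $G$ with identity $e$ and a finite set $S\subseteq G\setminus\{e\}$, the directed Cayley graph $\Gamma(G,S)$ has vertex set $G$ and arcs $(g,gs)$ for $g\in G$, $s\in S$. In a simple directed graph $(V,\mathcal A)$, $N^{\rm out}(x)=\{v\in V:(x,v)\in\mathcal A\}$, $d^{\rm out}_x=|N^{\rm out}(x)|$, and $d(x,y)$ is the length of a shortest directed path from $x$ to $y$. For $\alpha\in[0,1]$, the $\alpha$-lazy random walk measure at $x$ is $\mu^\alpha_x(x)=\alpha$, $\mu^\alpha_x(v)=\frac{1-\alpha}{d^{\rm out}_x}$ if $(x,v)\in\mathcal A$, and $\mu_x^\alpha(v)=0$ otherwise. For probability measures $\mu,\nu$ on $V$, $W(\mu,\nu)=\inf_A\sum_{u,v\in V}A(u,v)d(u,v)$, the infimum over couplings $A:V\times V\to[0,1]$ with $\sum_{v}A(u,v)=\mu(u)$ for all $u$ and $\sum_uA(u,v)=\nu(v)$ for all $v$. For distinct $x,y$, $\kappa_\alpha(x,y)=1-\frac{W(\mu_x^\alpha,\mu_y^\alpha)}{d(x,y)}$,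 and the Lin--Lu--Yau Ricci curvature is $\kappa(x,y)=\lim_{\alpha\to1^-}\frac{\kappa_\alpha(x,y)}{1-\alpha}$. *)

theory Defs
  imports "HOL-Analysis.Analysis" "HOL-Algebra.Group"
begin

text \<open>
  Groups given by generators and relations. A letter \<^term>\<open>(x, True)\<close> stands for the generator
  \<^term>\<open>x\<close> and \<^term>\<open>(x, False)\<close> for its formal inverse; a pair \<^term>\<open>(l, r)\<close> in \<^term>\<open>R\<close> is the
  relation \<open>l = r\<close>. The generating set is the whole type \<^typ>\<open>'x\<close>.
\<close>

inductive pres_eq :: "(('x \<times> bool) list \<times> ('x \<times> bool) list) set
    \<Rightarrow> ('x \<times> bool) list \<Rightarrow> ('x \<times> bool) list \<Rightarrow> bool"
  for R where
  refl: "pres_eq R w w"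
| sym: "pres_eq R v w \<Longrightarrow> pres_eq R w v"
| trans: "pres_eq R u v \<Longrightarrow> pres_eq R v w \<Longrightarrow> pres_eq R u w"
| cancel: "pres_eq R (u @ [(x, s), (x, \<not> s)] @ v) (u @ v)"
| rel: "(l, r) \<in> R \<Longrightarrow> pres_eq R (u @ l @ v) (u @ r @ v)"

definition pres_class :: "(('x \<times> bool) list \<times> ('x \<times> bool) list) set
    \<Rightarrow> ('x \<times> bool) list \<Rightarrow> ('x \<times> bool) list set" where
  "pres_class R w = {w'. pres_eq R w w'}"

definition presented_group :: "(('x \<times> bool) list \<times> ('x \<times> bool) list) set
    \<Rightarrow> ('x \<times> bool) list set monoid" where
  "presented_group R =
    \<lparr>carrier = range (pres_class R),
     mult = (\<lambda>X Y. {w. \<exists>x\<in>X. \<exists>y\<in>Y. pres_eq R (x @ y) w}),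
     one = pres_class R []\<rparr>"

datatype dih_gen = GenA | GenB

definition dihedral_relations ::
    "nat \<Rightarrow> ((dih_gen \<times> bool) list \<times> (dih_gen \<times> bool) list) set" where
  "dihedral_relations n =
    {(replicate n (GenA, True), []),
     (replicate 2 (GenB, True), []),
     ([(GenB, True), (GenA, True)], replicate (n - 1) (GenA, True) @ [(GenB, True)])}"

definition dihedral_group :: "nat \<Rightarrow> (dih_gen \<times> bool) list set monoid" where
  "dihedral_group n = presented_group (dihedral_relations n)"

definition dih_a :: "nat \<Rightarrow> (dih_gen \<times> bool) list set" where
  "dih_a n = pres_class (dihedral_relations n) [(GenA, True)]"

definition dih_b :: "nat \<Rightarrow> (dih_gen \<times> bool) list set" where
  "dih_b n = pres_class (dihedral_relations n) [(GenB, True)]"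

lemma pres_eq_append_left: "pres_eq R v w \<Longrightarrow> pres_eq R (u @ v) (u @ w)"
proof (induction rule: pres_eq.induct)
  case (cancel u' x s v)
  show ?case using pres_eq.cancel[of R "u @ u'" x s v] by simp
next
  case (rel l r u' v)
  then show ?case using pres_eq.rel[of l r R "u @ u'" v] by simp
qed (auto intro: pres_eq.intros)

lemma pres_eq_append_right: "pres_eq R v w \<Longrightarrow> pres_eq R (v @ u) (w @ u)"
proof (induction rule: pres_eq.induct)
  case (cancel u' x s v)
  show ?case using pres_eq.cancel[of R u' x s "v @ u"] by simp
next
  case (rel l r u' v)
  then show ?case using pres_eq.rel[of l r R u' "v @ u"] by simp
qed (auto intro: pres_eq.intros)

lemma pres_eq_append: "pres_eq R v v' \<Longrightarrow> pres_eq R w w' \<Longrightarrow> pres_eq R (v @ w) (v' @ w')"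
  by (meson pres_eq.trans pres_eq_append_left pres_eq_append_right)

lemma pres_class_eq_iff: "pres_class R v = pres_class R w \<longleftrightarrow> pres_eq R v w"
  unfolding pres_class_def by (blast intro: pres_eq.refl pres_eq.sym pres_eq.trans)

lemma presented_group_mult:
  "pres_class R v \<otimes>\<^bsub>presented_group R\<^esub> pres_class R w = pres_class R (v @ w)"
  unfolding presented_group_def pres_class_def
  by (auto intro: pres_eq.refl) (meson pres_eq.trans pres_eq_append)

lemma presented_group_one: "\<one>\<^bsub>presented_group R\<^esub> = pres_class R []"
  by (simp add: presented_group_def)

lemma presented_group_carrier: "carrier (presented_group R) = range (pres_class R)"
  by (simp add: presented_group_def)

lemma pres_eq_inverse: "pres_eq R (rev (map (\<lambda>(x, s). (x, \<not> s)) w) @ w) []"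
proof (induction w)
  case Nil
  show ?case by (simp add: pres_eq.refl)
next
  case (Cons p w)
  obtain x s where p: "p = (x, s)" by (cases p)
  have "pres_eq R (rev (map (\<lambda>(x, s). (x, \<not> s)) w) @ [(x, \<not> s), (x, \<not> \<not> s)] @ w)
          (rev (map (\<lambda>(x, s). (x, \<not> s)) w) @ w)"
    by (rule pres_eq.cancel)
  with Cons show ?case by (auto simp: p intro: pres_eq.trans)
qed

lemma group_presented_group: "group (presented_group R)"
proof (rule groupI)
  fix x assume "x \<in> carrier (presented_group R)"
  then obtain w where x: "x = pres_class R w" by (auto simp: presented_group_carrier)
  show "\<exists>y\<in>carrier (presented_group R). y \<otimes>\<^bsub>presented_group R\<^esub> x = \<one>\<^bsub>presented_group R\<^esub>"
    by (rule bexI[of _ "pres_class R (rev (map (\<lambda>(x, s). (x, \<not> s)) w))"])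
      (simp_all add: x presented_group_mult presented_group_one presented_group_carrier
        pres_class_eq_iff pres_eq_inverse rangeI)
qed (auto simp: presented_group_mult presented_group_one presented_group_carrier)

text \<open>
  The relations yield a group of order exactly \<open>2 n\<close>: left multiplication of letters on the
  normal forms \<open>a\<^sup>k b\<^sup>t\<close>, encoded as \<open>(k, t)\<close>, respects them.
\<close>

fun dih_step :: "nat \<Rightarrow> dih_gen \<times> bool \<Rightarrow> int \<times> bool \<Rightarrow> int \<times> bool" where
  "dih_step n (GenA, s) (k, t) = ((if s then k + 1 else k - 1) mod int n, t)"
| "dih_step n (GenB, s) (k, t) = ((- k) mod int n, \<not> t)"

definition dih_act :: "nat \<Rightarrow> (dih_gen \<times> bool) list \<Rightarrow> int \<times> bool \<Rightarrow> int \<times> bool" where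
  "dih_act n w p = foldr (dih_step n) w p"

lemma dih_act_append: "dih_act n (u @ v) p = dih_act n u (dih_act n v p)"
  by (simp add: dih_act_def)

lemma dih_act_in:
  assumes "n > 0" "fst p \<in> {0..<int n}"
  shows "fst (dih_act n w p) \<in> {0..<int n}"
proof (induction w)
  case (Cons q w)
  have "fst (dih_step n q p') \<in> {0..<int n}" for p'
    using assms(1) by (cases "(n, q, p')" rule: dih_step.cases) simp_all
  then show ?case by (simp add: dih_act_def)
qed (use assms in \<open>simp add: dih_act_def\<close>)

lemma dih_act_replicate_a:
  assumes "k' \<in> {0..<int n}"
  shows "dih_act n (replicate k (GenA, True)) (k', t) = ((k' + int k) mod int n, t)"
  using assms by (induction k) (simp_all add: dih_act_def mod_simps add_ac)

lemma pres_eq_dih_act: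
  assumes "n > 0" "pres_eq (dihedral_relations n) v w" "fst p \<in> {0..<int n}"
  shows "dih_act n v p = dih_act n w p"
  using assms(2,3)
proof (induction arbitrary: p rule: pres_eq.induct)
  case (cancel u x s v)
  obtain k t where q: "dih_act n v p = (k, t)" by (cases "dih_act n v p")
  have k: "k \<in> {0..<int n}" using dih_act_in[OF assms(1) cancel, of v] q by simp
  have "dih_act n [(x, s), (x, \<not> s)] (k, t) = (k, t)"
    using k by (cases x; cases s) (simp_all add: dih_act_def mod_simps)
  then show ?case by (simp only: dih_act_append q)
next
  case (rel l r u v)
  obtain k t where q: "dih_act n v p = (k, t)" by (cases "dih_act n v p")
  have k: "k \<in> {0..<int n}" using dih_act_in[OF assms(1) rel(2), of v] q by simp
  have minus: "((- k) mod int n + int (n - 1)) mod int n = (- (k + 1)) mod int n"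
  proof -
    have "((- k) mod int n + int (n - 1)) mod int n = (- (k + 1) + int n) mod int n"
      unfolding mod_add_left_eq using assms(1) by (simp add: of_nat_diff algebra_simps)
    then show ?thesis by (simp only: mod_add_self2)
  qed
  consider "l = replicate n (GenA, True)" "r = []"
    | "l = replicate 2 (GenB, True)" "r = []"
    | "l = [(GenB, True), (GenA, True)]" "r = replicate (n - 1) (GenA, True) @ [(GenB, True)]"
    using rel(1) unfolding dihedral_relations_def by blast
  then have "dih_act n l (k, t) = dih_act n r (k, t)"
  proof cases
    case 1
    then show ?thesis using k by (simp add: dih_act_replicate_a) (simp add: dih_act_def)
  next
    case 2
    then show ?thesis using k by (simp add: dih_act_def mod_simps numeral_2_eq_2)
  next
    case 3
    have "dih_act n [(GenB, True)] (k, t) = ((- k) mod int n, \<not> t)" by (simp add: dih_act_def)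
    moreover have "(- k) mod int n \<in> {0..<int n}" using assms(1) by simp
    ultimately have "dih_act n r (k, t) = ((- (k + 1)) mod int n, \<not> t)"
      using 3 minus by (simp add: dih_act_append dih_act_replicate_a)
    moreover have "dih_act n l (k, t) = ((- (k + 1)) mod int n, \<not> t)"
      using 3 by (simp add: dih_act_def mod_simps)
    ultimately show ?thesis by simp
  qed
  then show ?case by (simp only: dih_act_append q)
qed auto

definition dih_nf :: "nat \<Rightarrow> bool \<Rightarrow> (dih_gen \<times> bool) list" where
  "dih_nf k t = replicate k (GenA, True) @ (if t then [(GenB, True)] else [])"

lemma card_dihedral_group:
  assumes "n > 0"
  shows "card (carrier (dihedral_group n)) = 2 * n"
proof -
  let ?R = "dihedral_relations n" and ?a = "(GenA, True)" and ?b = "(GenB, True)"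
  let ?c = "pres_class ?R"
  interpret G: group "dihedral_group n"
    unfolding dihedral_group_def by (rule group_presented_group)
  have mult: "?c v \<otimes>\<^bsub>dihedral_group n\<^esub> ?c w = ?c (v @ w)" for v w
    by (simp add: dihedral_group_def presented_group_mult)
  have one: "\<one>\<^bsub>dihedral_group n\<^esub> = ?c []"
    by (simp add: dihedral_group_def presented_group_one)
  have carr: "carrier (dihedral_group n) = range ?c"
    by (simp add: dihedral_group_def presented_group_carrier)
  have an: "?c (u @ replicate n ?a @ v) = ?c (u @ v)" for u v
    using pres_eq.rel[of "replicate n ?a" "[]" ?R u v]
    by (simp add: dihedral_relations_def pres_class_eq_iff)
  have bb: "?c (u @ [?b, ?b] @ v) = ?c (u @ v)" for u v
    using pres_eq.rel[of "replicate 2 ?b" "[]" ?R u v]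
    by (simp add: dihedral_relations_def pres_class_eq_iff numeral_2_eq_2)
  have ba: "?c (u @ [?b, ?a] @ v) = ?c (u @ replicate (n - 1) ?a @ [?b] @ v)" for u v
    using pres_eq.rel[of "[?b, ?a]" "replicate (n - 1) ?a @ [?b]" ?R u v]
    by (simp add: dihedral_relations_def pres_class_eq_iff)
  define N where "N = (\<lambda>(k, t). ?c (dih_nf k t)) ` ({..<n} \<times> UNIV)"
  have red: "?c (dih_nf k t) \<in> N" for k t
  proof (induction k rule: less_induct)
    case (less k)
    show ?case
    proof (cases "k < n")
      case True
      then show ?thesis unfolding N_def by (intro image_eqI[of _ _ "(k, t)"]) auto
    next
      case False
      then have "replicate k ?a = replicate n ?a @ replicate (k - n) ?a"
        by (simp flip: replicate_add)
      then have "?c (dih_nf k t) = ?c (dih_nf (k - n) t)"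
        using an[of "[]" "dih_nf (k - n) t"] by (simp add: dih_nf_def)
      with less[of "k - n"] False assms show ?thesis by simp
    qed
  qed
  have conj: "\<exists>m. ?c (?b # replicate k ?a @ v) = ?c (replicate m ?a @ ?b # v)" for k v
  proof (induction k arbitrary: v)
    case 0
    show ?case by (rule exI[of _ 0]) simp
  next
    case (Suc k)
    then obtain m where m: "?c (?b # replicate k ?a @ ?a # v) = ?c (replicate m ?a @ ?b # ?a # v)"
      by blast
    have "?c (replicate m ?a @ ?b # ?a # v) = ?c (replicate (m + (n - 1)) ?a @ ?b # v)"
      using ba[of "replicate m ?a" v] by (simp add: replicate_add)
    with m show ?case by (metis append_Cons replicate_Suc replicate_append_same append_assoc
          append_Nil)
  qed
  have step_a: "?c (?a # dih_nf k t) \<in> N" for k t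
    using red[of "Suc k" t] by (simp add: dih_nf_def)
  have step_b: "?c (?b # dih_nf k t) \<in> N" for k t
  proof -
    obtain m where m: "?c (?b # dih_nf k t) = ?c (replicate m ?a @ ?b # (if t then [?b] else []))"
      using conj[of k] unfolding dih_nf_def by blast
    also have "\<dots> = ?c (dih_nf m (\<not> t))"
      using bb[of "replicate m ?a" "[]"] by (simp add: dih_nf_def)
    finally show ?thesis using red by simp
  qed
  have inv_a: "?c ((GenA, False) # w) = ?c (replicate (n - 1) ?a @ w)" for w
  proof -
    have "replicate n ?a = ?a # replicate (n - 1) ?a" using assms by (cases n) auto
    then show ?thesis
      using an[of "[(GenA, False)]" w] pres_eq.cancel[of ?R "[]" GenA False "replicate (n - 1) ?a @ w"]
      by (simp add: pres_class_eq_iff) (blast intro: pres_eq.sym pres_eq.trans)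
  qed
  have inv_b: "?c ((GenB, False) # w) = ?c (?b # w)" for w
    using bb[of "[(GenB, False)]" w] pres_eq.cancel[of ?R "[]" GenB False "?b # w"]
    by (simp add: pres_class_eq_iff) (blast intro: pres_eq.sym pres_eq.trans)
  have cong: "?c (u @ w) = ?c (u @ w')" if "?c w = ?c w'" for u w w'
    using that by (simp add: pres_class_eq_iff pres_eq_append_left)
  have inN: "?c w \<in> N" for w
  proof (induction w)
    case Nil
    show ?case using red[of 0 False] by (simp add: dih_nf_def)
  next
    case (Cons p w)
    then obtain k t where kt: "?c w = ?c (dih_nf k t)" by (auto simp: N_def)
    have "?c (p # w) = ?c (p # dih_nf k t)" using cong[OF kt, of "[p]"] by simp
    moreover have "?c (p # dih_nf k t) \<in> N"
    proof -
      obtain g s where p: "p = (g, s)" by (cases p)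
      show ?thesis
      proof (cases g; cases s)
        assume "g = GenA" "\<not> s"
        then have "?c (p # dih_nf k t) = ?c (dih_nf (n - 1 + k) t)"
          using inv_a p by (simp add: dih_nf_def replicate_add)
        then show ?thesis using red by simp
      qed (use p step_a step_b inv_b in simp_all)
    qed
    ultimately show ?case by simp
  qed
  then have "carrier (dihedral_group n) = N"
    unfolding carr N_def by auto
  moreover have "card N = 2 * n"
  proof -
    have "inj_on (\<lambda>(k, t). ?c (dih_nf k t)) ({..<n} \<times> UNIV)"
    proof (rule inj_onI, clarify)
      fix k t k' t'
      assume k: "k < n" "k' < n" and "?c (dih_nf k t) = ?c (dih_nf k' t')"
      then have "dih_act n (dih_nf k t) (0, False) = dih_act n (dih_nf k' t') (0, False)"
        by (intro pres_eq_dih_act) (use assms in \<open>auto simp: pres_class_eq_iff\<close>)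
      moreover have "dih_act n (dih_nf k t) (0, False) = (int k, t)" if "k < n" for k t
      proof -
        have "dih_act n (if t then [?b] else []) (0, False) = (0, t)" by (simp add: dih_act_def)
        then show ?thesis using that by (simp add: dih_nf_def dih_act_append dih_act_replicate_a)
      qed
      ultimately show "k = k' \<and> t = t'" using k by simp
    qed
    then show ?thesis by (simp add: N_def card_image card_cartesian_product)
  qed
  ultimately show ?thesis by simp
qed

definition cayley_arcs :: "('g, 'm) monoid_scheme \<Rightarrow> 'g set \<Rightarrow> ('g \<times> 'g) set" where
  "cayley_arcs G S = {(g, g \<otimes>\<^bsub>G\<^esub> s) | g s. g \<in> carrier G \<and> s \<in> S}"

text \<open>
  A simple directed graph is given by a vertex set \<open>V\<close> and a loop-free arc relation
  \<open>E \<subseteq> V \<times> V\<close>. The distance is meaningful only for vertices joined by a directed path; a directed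
  walk of least length is automatically a path.
\<close>

definition out_nbrs :: "'v set \<Rightarrow> ('v \<times> 'v) set \<Rightarrow> 'v \<Rightarrow> 'v set" where
  "out_nbrs V E x = {v \<in> V. (x, v) \<in> E}"

definition dir_dist :: "('v \<times> 'v) set \<Rightarrow> 'v \<Rightarrow> 'v \<Rightarrow> nat" where
  "dir_dist E x y = (LEAST k. (x, y) \<in> E ^^ k)"

definition lazy_walk :: "'v set \<Rightarrow> ('v \<times> 'v) set \<Rightarrow> real \<Rightarrow> 'v \<Rightarrow> 'v \<Rightarrow> real" where
  "lazy_walk V E \<alpha> x v =
    (if v = x then \<alpha>
     else if (x, v) \<in> E then (1 - \<alpha>) / real (card (out_nbrs V E x))
     else 0)"

definition coupling :: "'v set \<Rightarrow> ('v \<Rightarrow> real) \<Rightarrow> ('v \<Rightarrow> real) \<Rightarrow> ('v \<Rightarrow> 'v \<Rightarrow> real) \<Rightarrow> bool" where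
  "coupling V \<mu> \<nu> A \<longleftrightarrow>
    (\<forall>u\<in>V. \<forall>v\<in>V. 0 \<le> A u v \<and> A u v \<le> 1) \<and>
    (\<forall>u\<in>V. ((\<lambda>v. A u v) has_sum \<mu> u) V) \<and>
    (\<forall>v\<in>V. ((\<lambda>u. A u v) has_sum \<nu> v) V)"

text \<open>Couplings of infinite cost do not contribute to the infimum.\<close>

definition wasserstein ::
    "'v set \<Rightarrow> ('v \<times> 'v) set \<Rightarrow> ('v \<Rightarrow> real) \<Rightarrow> ('v \<Rightarrow> real) \<Rightarrow> real" where
  "wasserstein V E \<mu> \<nu> =
    Inf {c. \<exists>A. coupling V \<mu> \<nu> A \<and>
      ((\<lambda>(u, v). A u v * real (dir_dist E u v)) has_sum c) (V \<times> V)}"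

definition lazy_curvature :: "'v set \<Rightarrow> ('v \<times> 'v) set \<Rightarrow> real \<Rightarrow> 'v \<Rightarrow> 'v \<Rightarrow> real" where
  "lazy_curvature V E \<alpha> x y =
    1 - wasserstein V E (lazy_walk V E \<alpha> x) (lazy_walk V E \<alpha> y) / real (dir_dist E x y)"

text \<open>A predicate rather than a function, so that existence of the limit is part of the claim.\<close>

definition has_LLY_curvature :: "'v set \<Rightarrow> ('v \<times> 'v) set \<Rightarrow> 'v \<Rightarrow> 'v \<Rightarrow> real \<Rightarrow> bool" where
  "has_LLY_curvature V E x y k \<longleftrightarrow>
    ((\<lambda>\<alpha>. lazy_curvature V E \<alpha> x y / (1 - \<alpha>)) \<longlongrightarrow> k) (at_left 1)"

end

theory Submission
  imports Defs
begin

text \<open>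
  Transport plans are certified by Kantorovich duality: if a function \<open>f\<close> grows by at most \<open>1\<close>
  along every arc, and every pair \<open>(x, y)\<close> that carries mass in a plan is joined by a walk of
  length \<open>f y - f x\<close>, then the plan is optimal. Writing the elements of the dihedral group as
  \<open>a\<^sup>k b\<^sup>t\<close>, the arcs lead from \<open>a\<^sup>k\<close> to \<open>a\<^sup>k\<^sup>+\<^sup>1\<close>, from \<open>a\<^sup>k b\<close> to \<open>a\<^sup>k\<^sup>-\<^sup>1 b\<close>, and in both directions
  between \<open>a\<^sup>k\<close> and \<open>a\<^sup>k b\<close>, so that explicit plans and potentials can be written down.
  The case \<open>n = 3\<close> is special because the directed cycles of arcs of type \<open>a\<close> then offer shortcuts.
\<close>

section \<open>Transport in directed graphs\<close>

lemma relpow_potential_le: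
  fixes f :: "'v \<Rightarrow> real"
  assumes "\<And>x y. (x, y) \<in> E \<Longrightarrow> f y \<le> f x + 1" "(x, y) \<in> E ^^ k"
  shows "f y \<le> f x + real k"
  using assms(2)
proof (induction k arbitrary: y)
  case (Suc k)
  then obtain z where "(x, z) \<in> E ^^ k" "(z, y) \<in> E" by auto
  with Suc.IH assms(1) show ?case by fastforce
qed simp

lemma dir_dist_relpow: "(x, y) \<in> E\<^sup>* \<Longrightarrow> (x, y) \<in> E ^^ dir_dist E x y"
  unfolding dir_dist_def by (metis LeastI rtrancl_imp_relpow)

lemma dir_dist_le: "(x, y) \<in> E ^^ k \<Longrightarrow> dir_dist E x y \<le> k"
  unfolding dir_dist_def by (rule Least_le)

text \<open>The walk bounds the distance from above, and a potential that gains exactly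
  \<open>k\<close> bounds it from below.\<close>

lemma dir_dist_eqI:
  fixes f :: "'v \<Rightarrow> real"
  assumes "\<And>x y. (x, y) \<in> E \<Longrightarrow> f y \<le> f x + 1" "(x, y) \<in> E ^^ k" "f y = f x + real k"
  shows "dir_dist E x y = k"
proof -
  have "f y \<le> f x + real (dir_dist E x y)"
    using assms(1) dir_dist_relpow[OF relpow_imp_rtrancl[OF assms(2)]] by (rule relpow_potential_le)
  with assms(3) dir_dist_le[OF assms(2)] show ?thesis by simp
qed

lemma dir_dist_arc: "(x, y) \<in> E \<Longrightarrow> x \<noteq> y \<Longrightarrow> dir_dist E x y = 1"
  unfolding dir_dist_def by (rule Least_equality) (auto simp: Suc_le_eq intro: gr0I)

lemma sum_list_map_cong:
  "(\<And>x. x \<in> set L \<Longrightarrow> f x = g x) \<Longrightarrow> sum_list (map f L) = sum_list (map g L)"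
  by (metis map_cong)

lemma sum_sum_list_swap:
  fixes h :: "'a \<Rightarrow> 'b \<Rightarrow> 'c :: comm_monoid_add"
  shows "(\<Sum>v\<in>V. \<Sum>x\<leftarrow>L. h x v) = (\<Sum>x\<leftarrow>L. \<Sum>v\<in>V. h x v)"
  by (induction L) (simp_all add: sum.distrib)

text \<open>Weak duality: by the marginal conditions the left side is the total of
  \<open>A u v * (f v - f u)\<close>, and a shortest walk shows that \<open>f v - f u\<close> is at
  most the distance.\<close>

lemma coupling_cost_ge:
  fixes f :: "'v \<Rightarrow> real"
  assumes "finite V" "\<And>x y. x \<in> V \<Longrightarrow> y \<in> V \<Longrightarrow> (x, y) \<in> E\<^sup>*"
    and lip: "\<And>x y. (x, y) \<in> E \<Longrightarrow> f y \<le> f x + 1"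
    and "coupling V \<mu> \<nu> A"
  shows "(\<Sum>v\<in>V. f v * \<nu> v) - (\<Sum>u\<in>V. f u * \<mu> u)
    \<le> (\<Sum>(u, v)\<in>V \<times> V. A u v * real (dir_dist E u v))"
proof -
  have \<mu>: "\<mu> u = (\<Sum>v\<in>V. A u v)" and \<nu>: "\<nu> u = (\<Sum>v\<in>V. A v u)" if "u \<in> V" for u
    using assms(1,4) that
    by (metis coupling_def has_sum_finite has_sum_unique)+
  have "(\<Sum>v\<in>V. f v * \<nu> v) = (\<Sum>u\<in>V. \<Sum>v\<in>V. f v * A u v)"
    by (subst sum.swap) (simp add: \<nu> sum_distrib_left)
  then have "(\<Sum>v\<in>V. f v * \<nu> v) - (\<Sum>u\<in>V. f u * \<mu> u) = (\<Sum>u\<in>V. \<Sum>v\<in>V. A u v * (f v - f u))"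
    by (simp add: \<mu> sum_distrib_left algebra_simps sum_subtractf)
  also have "\<dots> \<le> (\<Sum>u\<in>V. \<Sum>v\<in>V. A u v * real (dir_dist E u v))"
  proof (intro sum_mono mult_left_mono)
    fix u v assume uv: "u \<in> V" "v \<in> V"
    show "f v - f u \<le> real (dir_dist E u v)"
      using relpow_potential_le[of E f, OF lip dir_dist_relpow[OF assms(2)[OF uv]]]
      by (simp add: algebra_simps)
    show "0 \<le> A u v" using assms(4) uv by (simp add: coupling_def)
  qed
  finally show ?thesis by (simp add: sum.cartesian_product)
qed

text \<open>An entry \<open>(w, k, x, y)\<close> of a plan moves the mass \<open>w\<close> from \<open>x\<close> to \<open>y\<close> along \<open>k\<close> arcs.\<close>

lemma wasserstein_eq_plan:
  fixes f :: "'v \<Rightarrow> real" and L :: "(real \<times> nat \<times> 'v \<times> 'v) list"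
  assumes fin: "finite V" and conn: "\<And>x y. x \<in> V \<Longrightarrow> y \<in> V \<Longrightarrow> (x, y) \<in> E\<^sup>*"
    and lip: "\<And>x y. (x, y) \<in> E \<Longrightarrow> f y \<le> f x + 1"
    and plan: "\<And>w k x y. (w, k, x, y) \<in> set L \<Longrightarrow>
      0 \<le> w \<and> x \<in> V \<and> y \<in> V \<and> (x, y) \<in> E ^^ k \<and> f y = f x + real k"
    and \<mu>: "\<And>u. \<mu> u = (\<Sum>(w, k, x, y)\<leftarrow>L. if x = u then w else 0)"
    and \<nu>: "\<And>v. \<nu> v = (\<Sum>(w, k, x, y)\<leftarrow>L. if y = v then w else 0)"
    and total: "(\<Sum>(w, k, x, y)\<leftarrow>L. w) = 1"
  shows "wasserstein V E \<mu> \<nu> = (\<Sum>(w, k, x, y)\<leftarrow>L. w * real k)"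
proof -
  \<comment> \<open>Entries are added up because several of them may share a source and a
    target.\<close>
  define A where "A u v = (\<Sum>(w, k, x, y)\<leftarrow>L. if x = u \<and> y = v then w else 0)" for u v
  have pairs: "(\<Sum>(w, k, x, y)\<leftarrow>L. g w k x y) = (\<Sum>(w, k, x, y)\<leftarrow>L. h w k x y)"
    if "\<And>w k x y. (w, k, x, y) \<in> set L \<Longrightarrow> g w k x y = h w k x y"
    for g h :: "real \<Rightarrow> nat \<Rightarrow> 'v \<Rightarrow> 'v \<Rightarrow> real"
    using that by (intro sum_list_map_cong) auto
  have A_sum1: "(\<Sum>v\<in>V. A u v) = \<mu> u" for u
    unfolding A_def \<mu> sum_sum_list_swap case_prod_beta
  proof (rule sum_list_map_cong)
    fix z assume "z \<in> set L"
    obtain w k x y where z: "z = (w, k, x, y)" by (cases z)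
    have "y \<in> V" using plan \<open>z \<in> set L\<close> z by blast
    then show "(\<Sum>v\<in>V. if fst (snd (snd z)) = u \<and> snd (snd (snd z)) = v then fst z else 0)
        = (if fst (snd (snd z)) = u then fst z else 0)"
      using fin by (cases "x = u") (auto simp: z)
  qed
  have A_sum2: "(\<Sum>u\<in>V. A u v) = \<nu> v" for v
    unfolding A_def \<nu> sum_sum_list_swap case_prod_beta
  proof (rule sum_list_map_cong)
    fix z assume "z \<in> set L"
    obtain w k x y where z: "z = (w, k, x, y)" by (cases z)
    have "x \<in> V" using plan \<open>z \<in> set L\<close> z by blast
    then show "(\<Sum>u\<in>V. if fst (snd (snd z)) = u \<and> snd (snd (snd z)) = v then fst z else 0)
        = (if snd (snd (snd z)) = v then fst z else 0)"
      using fin by (cases "y = v") (auto simp: z)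
  qed
  have A_le: "A u v \<le> 1" for u v
    unfolding A_def total[symmetric]
    by (intro sum_list_mono) (use plan in auto)
  have A_ge: "0 \<le> A u v" for u v
    unfolding A_def by (intro sum_list_nonneg) (use plan in auto)
  have coup: "coupling V \<mu> \<nu> A"
    unfolding coupling_def
    using A_le A_ge fin by (auto intro!: has_sum_finiteI simp: A_sum1 A_sum2)
  have cost: "(\<Sum>(u, v)\<in>V \<times> V. A u v * real (dir_dist E u v)) = (\<Sum>(w, k, x, y)\<leftarrow>L. w * real k)"
  proof -
    have "(\<Sum>(u, v)\<in>V \<times> V. A u v * real (dir_dist E u v)) =
      (\<Sum>(w, k, x, y)\<leftarrow>L. \<Sum>p\<in>V \<times> V. if p = (x, y) then w * real (dir_dist E x y) else 0)"
      unfolding A_def case_prod_beta sum_list_mult_const[symmetric] sum_sum_list_swap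
      by (intro sum_list_map_cong sum.cong refl) auto
    also have "\<dots> = (\<Sum>(w, k, x, y)\<leftarrow>L. w * real k)"
    proof (rule pairs)
      fix w k x y assume "(w, k, x, y) \<in> set L"
      note p = plan[OF this]
      then have "dir_dist E x y = k" using dir_dist_eqI[of E f x y k] lip by blast
      with p fin show "(\<Sum>p\<in>V \<times> V. if p = (x, y) then w * real (dir_dist E x y) else 0) = w * real k"
        by simp
    qed
    finally show ?thesis .
  qed
  \<comment> \<open>Complementary slackness: \<open>f\<close> gains exactly \<open>k\<close> on each
    entry, so the dual value meets the cost of the plan.\<close>
  have dual: "(\<Sum>v\<in>V. f v * \<nu> v) - (\<Sum>u\<in>V. f u * \<mu> u) = (\<Sum>(w, k, x, y)\<leftarrow>L. w * real k)"
  proof -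
    have "(\<Sum>v\<in>V. f v * \<nu> v) = (\<Sum>(w, k, x, y)\<leftarrow>L. \<Sum>v\<in>V. if y = v then f y * w else 0)"
      unfolding \<nu> case_prod_beta sum_list_const_mult[symmetric] sum_sum_list_swap
      by (intro sum_list_map_cong sum.cong refl) auto
    also have "\<dots> = (\<Sum>(w, k, x, y)\<leftarrow>L. f y * w)"
      by (rule pairs) (use plan fin in auto)
    finally have 1: "(\<Sum>v\<in>V. f v * \<nu> v) = (\<Sum>(w, k, x, y)\<leftarrow>L. f y * w)" .
    have "(\<Sum>u\<in>V. f u * \<mu> u) = (\<Sum>(w, k, x, y)\<leftarrow>L. \<Sum>u\<in>V. if x = u then f x * w else 0)"
      unfolding \<mu> case_prod_beta sum_list_const_mult[symmetric] sum_sum_list_swap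
      by (intro sum_list_map_cong sum.cong refl) auto
    also have "\<dots> = (\<Sum>(w, k, x, y)\<leftarrow>L. f x * w)"
      by (rule pairs) (use plan fin in auto)
    finally have 2: "(\<Sum>u\<in>V. f u * \<mu> u) = (\<Sum>(w, k, x, y)\<leftarrow>L. f x * w)" .
    have "(\<Sum>(w, k, x, y)\<leftarrow>L. w * real k) = (\<Sum>(w, k, x, y)\<leftarrow>L. f y * w - f x * w)"
      by (rule pairs) (use plan in \<open>fastforce simp: algebra_simps\<close>)
    then show ?thesis unfolding 1 2 by (simp add: case_prod_beta' sum_list_subtractf)
  qed
  show ?thesis unfolding wasserstein_def
  proof (rule cInf_eq_minimum)
    have "((\<lambda>(u, v). A u v * real (dir_dist E u v)) has_sum (\<Sum>(w, k, x, y)\<leftarrow>L. w * real k)) (V \<times> V)"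
      using fin cost by (intro has_sum_finiteI) auto
    with coup show "(\<Sum>(w, k, x, y)\<leftarrow>L. w * real k) \<in> {c. \<exists>A. coupling V \<mu> \<nu> A \<and>
      ((\<lambda>(u, v). A u v * real (dir_dist E u v)) has_sum c) (V \<times> V)}" by blast
  next
    fix c assume "c \<in> {c. \<exists>A. coupling V \<mu> \<nu> A \<and>
      ((\<lambda>(u, v). A u v * real (dir_dist E u v)) has_sum c) (V \<times> V)}"
    then obtain B where B: "coupling V \<mu> \<nu> B"
      "((\<lambda>(u, v). B u v * real (dir_dist E u v)) has_sum c) (V \<times> V)" by blast
    have "c = (\<Sum>(u, v)\<in>V \<times> V. B u v * real (dir_dist E u v))"
      using has_sum_unique[OF B(2) has_sum_finite] fin by simp
    moreover have "(\<Sum>v\<in>V. f v * \<nu> v) - (\<Sum>u\<in>V. f u * \<mu> u)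
        \<le> (\<Sum>(u, v)\<in>V \<times> V. B u v * real (dir_dist E u v))"
      using fin conn lip B(1) by (rule coupling_cost_ge)
    ultimately show "(\<Sum>(w, k, x, y)\<leftarrow>L. w * real k) \<le> c" by (simp only: dual)
  qed
qed

text \<open>A sum of three point masses has the shape in which \<open>wasserstein_eq_plan\<close>
  expects its marginals; distinctness keeps the masses apart.\<close>

lemma lazy_walk_two:
  assumes "out_nbrs V E x = {y, z}" "\<And>v. (x, v) \<in> E \<Longrightarrow> v \<in> V" "distinct [x, y, z]"
  shows "lazy_walk V E \<alpha> x u =
    (if x = u then \<alpha> else 0) + (if y = u then (1 - \<alpha>) / 2 else 0) + (if z = u then (1 - \<alpha>) / 2 else 0)"
proof -
  have "(x, v) \<in> E \<longleftrightarrow> v = y \<or> v = z" for v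
    using assms(1,2) unfolding out_nbrs_def by blast
  with assms show ?thesis by (auto simp: lazy_walk_def)
qed

text \<open>The distance is 1, so the quotient is constantly \<open>k\<close> to the left of 1. The
  bound 1/2 ensures that weights such as \<open>\<alpha> - (1 - \<alpha>) / 2\<close> in a plan are
  nonnegative.\<close>

lemma has_LLY_curvatureI:
  assumes "(x, y) \<in> E" "x \<noteq> y"
    and W: "\<And>\<alpha>. 1 / 2 < \<alpha> \<Longrightarrow> \<alpha> < 1 \<Longrightarrow>
      wasserstein V E (lazy_walk V E \<alpha> x) (lazy_walk V E \<alpha> y) = 1 - k * (1 - \<alpha>)"
  shows "has_LLY_curvature V E x y k"
  unfolding has_LLY_curvature_def
proof (rule tendsto_eventually)
  show "\<forall>\<^sub>F \<alpha> in at_left 1. lazy_curvature V E \<alpha> x y / (1 - \<alpha>) = k"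
    unfolding eventually_at_left_field
    by (rule exI[of _ "1 / 2"]) (simp add: lazy_curvature_def W dir_dist_arc[OF assms(1,2)])
qed

section \<open>The Cayley graph of the dihedral group\<close>

locale dihedral_cayley =
  fixes n :: nat
  assumes n3: "3 \<le> n"
begin

abbreviation "V \<equiv> carrier (dihedral_group n)"
abbreviation "E \<equiv> cayley_arcs (dihedral_group n) {dih_a n, dih_b n}"

text \<open>The element \<open>a^k b^t\<close>; \<open>k\<close> is not reduced modulo
  \<open>n\<close>, so exponents can be added freely in \<open>nat\<close>.\<close>

definition P :: "nat \<Rightarrow> bool \<Rightarrow> (dih_gen \<times> bool) list set" where
  "P k t = pres_class (dihedral_relations n) (dih_nf k t)"

lemma P_period: "P (k + n) t = P k t"
  unfolding P_def dih_nf_def pres_class_eq_iff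
  using pres_eq.rel[of "replicate n (GenA, True)" "[]" "dihedral_relations n"
      "replicate k (GenA, True)" "if t then [(GenB, True)] else []"]
  by (simp add: dihedral_relations_def replicate_add)

lemma P_mod: "P (k mod n) t = P k t"
proof -
  have "P (k mod n + n * m) t = P (k mod n) t" for m
  proof (induction m)
    case (Suc m)
    then show ?case using P_period[of "k mod n + n * m" t] by (simp add: algebra_simps)
  qed simp
  from this[of "k div n"] show ?thesis by simp
qed

text \<open>The action on normal forms separates the classes: \<open>a^k b^t\<close> sends
  \<open>(0, False)\<close> to \<open>(k mod n, t)\<close>.\<close>

lemma P_eq_iff: "P k t = P k' t' \<longleftrightarrow> k mod n = k' mod n \<and> t = t'"
proof
  assume "P k t = P k' t'"
  then have "dih_act n (dih_nf k t) (0, False) = dih_act n (dih_nf k' t') (0, False)"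
    unfolding P_def by (intro pres_eq_dih_act) (use n3 in \<open>auto simp: pres_class_eq_iff\<close>)
  moreover have "dih_act n (dih_nf k t) (0, False) = (int k mod int n, t)" for k t
  proof -
    have "dih_act n (if t then [(GenB, True)] else []) (0, False) = (0, t)"
      by (simp add: dih_act_def)
    then show ?thesis using n3 by (simp add: dih_nf_def dih_act_append dih_act_replicate_a)
  qed
  ultimately show "k mod n = k' mod n \<and> t = t'" by (simp flip: of_nat_mod)
next
  assume "k mod n = k' mod n \<and> t = t'"
  then have "P (k mod n) t = P (k' mod n) t'" by simp
  then show "P k t = P k' t'" by (simp only: P_mod)
qed

text \<open>By counting: the normal forms give \<open>2 * n\<close> distinct elements, which is the
  order of the group.\<close>

lemma V_eq: "V = (\<lambda>(k, t). P k t) ` ({..<n} \<times> UNIV)"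
proof -
  have card: "card V = 2 * n" using n3 by (simp add: card_dihedral_group)
  then have "finite V" using n3 by (intro card_ge_0_finite) simp
  moreover have "(\<lambda>(k, t). P k t) ` ({..<n} \<times> UNIV) \<subseteq> V"
    by (auto simp: P_def dihedral_group_def presented_group_carrier)
  moreover have "inj_on (\<lambda>(k, t). P k t) ({..<n} \<times> UNIV)"
    by (auto simp: inj_on_def P_eq_iff)
  then have "card ((\<lambda>(k, t). P k t) ` ({..<n} \<times> UNIV)) = 2 * n"
    by (simp add: card_image card_cartesian_product)
  ultimately show ?thesis using card by (metis card_subset_eq)
qed

lemma finite_V: "finite V"
  by (simp add: V_eq)

lemma P_in_V: "P k t \<in> V"
proof -
  have "k mod n < n" using n3 by simp
  then have "P (k mod n) t \<in> V" unfolding V_eq by (intro image_eqI[of _ _ "(k mod n, t)"]) auto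
  then show ?thesis by (simp only: P_mod)
qed

text \<open>The relation \<open>ba = a^(n-1) b\<close> moves the new \<open>a\<close> to the left of
  \<open>b\<close>, so reflections are rotated backwards.\<close>

lemma P_mult_a: "P k t \<otimes>\<^bsub>dihedral_group n\<^esub> dih_a n = P (if t then k + (n - 1) else k + 1) t"
proof (cases t)
  case True
  then show ?thesis
    using pres_eq.rel[of "[(GenB, True), (GenA, True)]" "replicate (n - 1) (GenA, True) @ [(GenB, True)]"
        "dihedral_relations n" "replicate k (GenA, True)" "[]"]
    by (simp add: P_def dih_a_def dihedral_group_def presented_group_mult pres_class_eq_iff
        dih_nf_def dihedral_relations_def replicate_add)
next
  case False
  then show ?thesis
    by (simp add: P_def dih_a_def dihedral_group_def presented_group_mult dih_nf_def
        replicate_append_same)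
qed

lemma P_mult_b: "P k t \<otimes>\<^bsub>dihedral_group n\<^esub> dih_b n = P k (\<not> t)"
proof (cases t)
  case True
  then show ?thesis
    using pres_eq.rel[of "replicate 2 (GenB, True)" "[]"
        "dihedral_relations n" "replicate k (GenA, True)" "[]"]
    by (simp add: P_def dih_b_def dihedral_group_def presented_group_mult pres_class_eq_iff
        dih_nf_def dihedral_relations_def numeral_2_eq_2)
next
  case False
  then show ?thesis
    by (simp add: P_def dih_b_def dihedral_group_def presented_group_mult dih_nf_def)
qed

section \<open>Arcs, connectedness and potentials\<close>

lemma P_arc_iff:
  "(P k t, v) \<in> E \<longleftrightarrow> v = P (if t then k + (n - 1) else k + 1) t \<or> v = P k (\<not> t)"
proof -
  have "(P k t, v) \<in> E \<longleftrightarrow> v = P k t \<otimes>\<^bsub>dihedral_group n\<^esub> dih_a n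
    \<or> v = P k t \<otimes>\<^bsub>dihedral_group n\<^esub> dih_b n"
    unfolding cayley_arcs_def using P_in_V[of k t] by auto
  then show ?thesis by (simp only: P_mult_a P_mult_b)
qed

lemma arc_rot: "(P k False, P (Suc k) False) \<in> E"
  by (simp add: P_arc_iff)

lemma arc_rot_back: "(P (Suc k) True, P k True) \<in> E"
proof -
  have "Suc k + (n - 1) = k + n" using n3 by simp
  then have "P k True = P (if True then Suc k + (n - 1) else Suc k + 1) True"
    by (simp only: if_True P_period)
  then show ?thesis unfolding P_arc_iff by (rule disjI1)
qed

lemma arc_flip: "(P k t, P k (\<not> t)) \<in> E"
  by (simp add: P_arc_iff)

text \<open>Backward arcs are indexed by their target, which avoids subtraction in
  \<open>nat\<close>.\<close>

lemma arc_cases: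
  assumes "(x, y) \<in> E"
  obtains k where "x = P k False" "y = P (Suc k) False"
  | k where "x = P (Suc k) True" "y = P k True"
  | k t where "x = P k t" "y = P k (\<not> t)"
proof -
  have "x \<in> V" using assms by (auto simp: cayley_arcs_def)
  then obtain k t where x: "x = P k t" by (auto simp: V_eq)
  from assms consider "y = P (if t then k + (n - 1) else k + 1) t" | "y = P k (\<not> t)"
    unfolding x P_arc_iff by blast
  then show ?thesis
  proof cases
    case 1
    have "Suc (k + (n - 1)) = k + n" using n3 by simp
    then have "P (Suc (k + (n - 1))) True = P k True" by (simp only: P_period)
    with 1 show ?thesis using that(1)[of k] that(2)[of "k + (n - 1)"] by (cases t) (simp_all add: x)
  next
    case 2
    with x show ?thesis by (rule that(3))
  qed
qed

text \<open>Flip to a rotation if necessary, go forward around the cycle of rotations, and flip at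
  the end.\<close>

lemma connected:
  assumes "x \<in> V" "y \<in> V"
  shows "(x, y) \<in> E\<^sup>*"
proof -
  obtain k t j s where x: "x = P k t" and y: "y = P j s" and k: "k < n"
    using assms by (auto simp: V_eq)
  have flip: "(P k t, P k t') \<in> E\<^sup>*" for k t t'
    using arc_flip[of k t] by (cases "t = t'") auto
  have rot: "(P k False, P (k + m) False) \<in> E\<^sup>*" for m
    by (induction m) (use arc_rot in \<open>auto intro: rtrancl_into_rtrancl\<close>)
  \<comment> \<open>The extra turn by \<open>n\<close> keeps the number of forward steps from being
    truncated when \<open>j < k\<close>.\<close>
  have "P (k + (j + n - k)) False = P j False"
    using k P_period[of j False] by simp
  with rot[of "j + n - k"] have "(P k False, P j False) \<in> E\<^sup>*" by metis
  with flip[of k t False] flip[of j False s] show ?thesis unfolding x y by (meson rtrancl_trans)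
qed

text \<open>The three conditions bound the growth along the arcs of type \<open>a\<close> leaving \<open>a\<^sup>k\<close>,
  of type \<open>a\<close> entering \<open>a\<^sup>k b\<close>, and of type \<open>b\<close>.\<close>

lemma potential_exists:
  fixes F :: "nat \<Rightarrow> bool \<Rightarrow> real"
  assumes "\<And>k. k < n \<Longrightarrow> F (Suc k mod n) False \<le> F k False + 1"
    and "\<And>k. k < n \<Longrightarrow> F k True \<le> F (Suc k mod n) True + 1"
    and "\<And>k. k < n \<Longrightarrow> \<bar>F k True - F k False\<bar> \<le> 1"
  obtains f where "\<And>k t. f (P k t) = F (k mod n) t" "\<And>x y. (x, y) \<in> E \<Longrightarrow> f y \<le> f x + 1"
proof -
  \<comment> \<open>The value is read off from any representation of \<open>x\<close>;
    \<open>P_eq_iff\<close> makes the choice irrelevant.\<close>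
  define f where "f x = (THE r. \<exists>k t. x = P k t \<and> r = F (k mod n) t)" for x
  have f: "f (P k t) = F (k mod n) t" for k t
    unfolding f_def by (rule the_equality) (auto simp: P_eq_iff)
  have "f y \<le> f x + 1" if "(x, y) \<in> E" for x y
    using that
  proof (cases rule: arc_cases)
    case (1 k)
    then show ?thesis using assms(1)[of "k mod n"] n3 by (simp add: f mod_Suc_eq)
  next
    case (2 k)
    then show ?thesis using assms(2)[of "k mod n"] n3 by (simp add: f mod_Suc_eq)
  next
    case (3 k t)
    then show ?thesis using assms(3)[of "k mod n"] n3 by (cases t) (simp_all add: f abs_le_iff)
  qed
  with f show ?thesis using that by blast
qed

lemma lazy_walk_P:
  "lazy_walk V E \<alpha> (P k t) u = (if P k t = u then \<alpha> else 0)
    + (if P (if t then k + (n - 1) else k + 1) t = u then (1 - \<alpha>) / 2 else 0)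
    + (if P k (\<not> t) = u then (1 - \<alpha>) / 2 else 0)"
proof (rule lazy_walk_two)
  show "out_nbrs V E (P k t) = {P (if t then k + (n - 1) else k + 1) t, P k (\<not> t)}"
    using P_in_V by (auto simp: out_nbrs_def P_arc_iff)
  show "v \<in> V" if "(P k t, v) \<in> E" for v
    using that P_in_V by (auto simp: P_arc_iff)
  have "(k + m) mod n \<noteq> k mod n" if "0 < m" "m < n" for m
  proof
    assume "(k + m) mod n = k mod n"
    then have "n dvd m" by (metis add_diff_cancel_left' mod_eq_dvd_iff_nat le_add1)
    with that show False by (simp add: nat_dvd_not_less)
  qed
  from this[of 1] this[of "n - 1"] n3
  show "distinct [P k t, P (if t then k + (n - 1) else k + 1) t, P k (\<not> t)]"
    by (auto simp: P_eq_iff)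
qed

section \<open>Optimal plans and the two curvatures\<close>

lemma one_eq: "\<one>\<^bsub>dihedral_group n\<^esub> = P 0 False"
  and a_eq: "dih_a n = P 1 False"
  and b_eq: "dih_b n = P 0 True"
  by (simp_all add: P_def dih_nf_def dihedral_group_def presented_group_one dih_a_def dih_b_def)

lemma path_b_ab: "(P 0 True, P 1 True) \<in> E ^^ 3"
proof -
  have "(P 0 True, P 0 False) \<in> E" "(P 1 False, P 1 True) \<in> E"
    using arc_flip[of 0 True] arc_flip[of 1 False] by simp_all
  with arc_rot[of 0] show ?thesis by (auto simp: numeral_3_eq_3)
qed

text \<open>The plan is left multiplication by \<open>a\<close>: it moves \<open>e\<close> to
  \<open>a\<close> and \<open>a\<close> to \<open>a^2\<close> along one arc each, and
  \<open>b\<close> to \<open>ab\<close> along \<open>d\<close> arcs.\<close>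

lemma curvature_a: "has_LLY_curvature V E (P 0 False) (P 1 False) (if n = 3 then - 1 / 2 else - 1)"
proof (rule has_LLY_curvatureI)
  show "(P 0 False, P 1 False) \<in> E" using arc_rot[of 0] by simp
  show "P 0 False \<noteq> P 1 False" using n3 by (simp add: P_eq_iff)
  fix \<alpha> :: real assume \<alpha>: "1 / 2 < \<alpha>" "\<alpha> < 1"
  \<comment> \<open>The potential must gain 1 from \<open>e\<close> to \<open>a\<close>, 1 from
    \<open>a\<close> to \<open>a^2\<close> and \<open>d\<close> from \<open>b\<close> to
    \<open>ab\<close>. For \<open>n = 3\<close> it climbs along \<open>b, a^2 b, ab\<close>,
    otherwise along \<open>b, e, a, ab\<close>; the other values only respect the growth
    bounds.\<close>
  define F :: "nat \<Rightarrow> bool \<Rightarrow> real" where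
    "F k t = (if n = 3 then if t then (if k = 0 then 0 else 3 - real k) else real k
      else if t then (if k = 0 then 0 else if k = 1 then 3 else if k = 2 then 2 else 1)
      else (if k = 0 then 1 else if k = 2 then 3 else 2))" for k t
  obtain f where f: "\<And>k t. f (P k t) = F (k mod n) t"
    and lip: "\<And>x y. (x, y) \<in> E \<Longrightarrow> f y \<le> f x + 1"
    by (rule potential_exists[of F]) (use n3 in \<open>auto simp: F_def mod_Suc\<close>)
  define d :: nat where "d = (if n = 3 then 2 else 3)"
  have "(P 0 True, P 1 True) \<in> E ^^ d"
  proof (cases "n = 3")
    case True
    \<comment> \<open>Two backward rotations reach \<open>ab\<close> from \<open>b\<close>, since
      \<open>b = a^3 b\<close>.\<close>
    have "P 0 True = P 3 True" using P_period[of 0 True] True by simp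
    then have "(P 0 True, P 2 True) \<in> E" "(P 2 True, P 1 True) \<in> E"
      using arc_rot_back[of 2] arc_rot_back[of 1] by (simp_all add: numeral_eq_Suc)
    then show ?thesis using True by (auto simp: d_def numeral_2_eq_2)
  qed (use path_b_ab in \<open>simp add: d_def\<close>)
  let ?L = "[(\<alpha>, 1, P 0 False, P 1 False), ((1 - \<alpha>) / 2, 1, P 1 False, P 2 False),
    ((1 - \<alpha>) / 2, d, P 0 True, P 1 True)]"
  have "wasserstein V E (lazy_walk V E \<alpha> (P 0 False)) (lazy_walk V E \<alpha> (P 1 False))
    = (\<Sum>(w, k, x, y)\<leftarrow>?L. w * real k)"
  proof (rule wasserstein_eq_plan[where f = f, OF finite_V connected lip])
    fix w k x y assume "(w, k, x, y) \<in> set ?L"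
    then show "0 \<le> w \<and> x \<in> V \<and> y \<in> V \<and> (x, y) \<in> E ^^ k \<and> f y = f x + real k"
      using \<alpha> n3 \<open>(P 0 True, P 1 True) \<in> E ^^ d\<close> arc_rot[of 0] arc_rot[of 1] P_in_V
      by (auto simp: f F_def d_def numeral_2_eq_2)
  qed (use \<alpha> in \<open>auto simp: lazy_walk_P numeral_2_eq_2\<close>)
  also have "\<dots> = 1 - (if n = 3 then - 1 / 2 else - 1) * (1 - \<alpha>)"
    by (cases "n = 3") (simp_all add: d_def field_simps)
  finally show "wasserstein V E (lazy_walk V E \<alpha> (P 0 False)) (lazy_walk V E \<alpha> (P 1 False))
    = 1 - (if n = 3 then - 1 / 2 else - 1) * (1 - \<alpha>)" .
qed

text \<open>Mass \<open>(1 - \<alpha>) / 2\<close> common to both measures stays at \<open>e\<close>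
  and at \<open>b\<close>. The surplus at \<open>e\<close> crosses to \<open>b\<close>, and the mass
  at \<open>a\<close> goes to \<open>a^(n-1) b\<close> in \<open>d\<close> steps.\<close>

lemma curvature_b: "has_LLY_curvature V E (P 0 False) (P 0 True) (if n = 3 then 1 / 2 else 0)"
proof (rule has_LLY_curvatureI)
  show "(P 0 False, P 0 True) \<in> E" using arc_flip[of 0 False] by simp
  show "P 0 False \<noteq> P 0 True" by (simp add: P_eq_iff)
  fix \<alpha> :: real assume \<alpha>: "1 / 2 < \<alpha>" "\<alpha> < 1"
  \<comment> \<open>The summand for \<open>t\<close> gives the gain 1 from \<open>e\<close> to
    \<open>b\<close>. The part depending on \<open>k\<close> is 0 at \<open>a\<close> and
    \<open>d - 1\<close> at \<open>a^(n-1)\<close>, so the long move gains \<open>d\<close>.\<close>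
  define F :: "nat \<Rightarrow> bool \<Rightarrow> real" where
    "F k t = (if k = 1 then 0 else if k = 0 then (if n = 3 then 0 else 1)
      else if k = 2 then 1 else 2) + (if t then 1 else 0)" for k t
  obtain f where f: "\<And>k t. f (P k t) = F (k mod n) t"
    and lip: "\<And>x y. (x, y) \<in> E \<Longrightarrow> f y \<le> f x + 1"
    by (rule potential_exists[of F]) (use n3 in \<open>auto simp: F_def mod_Suc\<close>)
  define d :: nat where "d = (if n = 3 then 2 else 3)"
  have path: "(P 1 False, P (n - 1) True) \<in> E ^^ d"
  proof (cases "n = 3")
    case True
    \<comment> \<open>Here \<open>n - 1 = 2\<close>, so one forward rotation and a flip
      suffice.\<close>
    have "(P 1 False, P 2 False) \<in> E" "(P 2 False, P 2 True) \<in> E"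
      using arc_rot[of 1] arc_flip[of 2 False] by (simp_all add: numeral_eq_Suc)
    then show ?thesis using True by (auto simp: d_def numeral_2_eq_2)
  next
    case False
    \<comment> \<open>The walk is \<open>a, ab, b, a^(n-1) b\<close>: a flip followed by two
      backward rotations.\<close>
    have "(P 1 False, P 1 True) \<in> E" "(P 1 True, P 0 True) \<in> E" "(P 0 True, P (n - 1) True) \<in> E"
      using arc_flip[of 1 False] arc_rot_back[of 0] by (simp_all add: P_arc_iff)
    then show ?thesis using False by (auto simp: d_def numeral_3_eq_3)
  qed
  let ?L = "[((1 - \<alpha>) / 2, 0, P 0 False, P 0 False), ((1 - \<alpha>) / 2, 0, P 0 True, P 0 True),
    (\<alpha> - (1 - \<alpha>) / 2, 1, P 0 False, P 0 True), ((1 - \<alpha>) / 2, d, P 1 False, P (n - 1) True)]"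
  have "wasserstein V E (lazy_walk V E \<alpha> (P 0 False)) (lazy_walk V E \<alpha> (P 0 True))
    = (\<Sum>(w, k, x, y)\<leftarrow>?L. w * real k)"
  proof (rule wasserstein_eq_plan[where f = f, OF finite_V connected lip])
    fix w k x y assume "(w, k, x, y) \<in> set ?L"
    then show "0 \<le> w \<and> x \<in> V \<and> y \<in> V \<and> (x, y) \<in> E ^^ k \<and> f y = f x + real k"
      using \<alpha> n3 path arc_flip[of 0 False] P_in_V
      by (auto simp: f F_def d_def)
  qed (use \<alpha> in \<open>auto simp: lazy_walk_P field_simps\<close>)
  also have "\<dots> = 1 - (if n = 3 then 1 / 2 else 0) * (1 - \<alpha>)"
    by (cases "n = 3") (simp_all add: d_def field_simps)
  finally show "wasserstein V E (lazy_walk V E \<alpha> (P 0 False)) (lazy_walk V E \<alpha> (P 0 True))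
    = 1 - (if n = 3 then 1 / 2 else 0) * (1 - \<alpha>)" .
qed

end

theorem proposition4p1:
  fixes n :: nat
  assumes "n \<ge> 3"
  shows "has_LLY_curvature (carrier (dihedral_group n))
           (cayley_arcs (dihedral_group n) {dih_a n, dih_b n})
           \<one>\<^bsub>dihedral_group n\<^esub> (dih_a n) (if n = 3 then - 1 / 2 else - 1)
       \<and> has_LLY_curvature (carrier (dihedral_group n))
           (cayley_arcs (dihedral_group n) {dih_a n, dih_b n})
           \<one>\<^bsub>dihedral_group n\<^esub> (dih_b n) (if n = 3 then 1 / 2 else 0)"
proof -
  interpret dihedral_cayley n using assms by unfold_locales
  show ?thesis
    using curvature_a curvature_b unfolding one_eq a_eq[symmetric] b_eq[symmetric] by (rule conjI)
qed

end
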